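(* Let $n\ge 4$ be even. Then scenery reconstruction is impossible for the $n$-dimensional hypercube: there is no measurable map $R$ from $\{-1,1\}^{\mathbb{N}}$ to the set of functions $\{-1,1\}^n\to\{-1,1\}$ such that for every $f:\{-1,1\}^n\to\{-1,1\}$, with probability $1$ the function $R\big((f(S_i))_{i\ge 0}\big)$ is isomorphic to $f$.
   Context: The hypercube $\{-1,1\}^n$ is regarded as a graph in which two vertices are adjacent iff they differ in exactly one coordinate. $(S_i)_{i\geq 0}$ denotes simple random walk on this graph: $S_0$ is uniformly distributed over the vertices and, given the past, $S_{i+1}$ is a uniformly random neighbor of $S_i$. The scenery process of $f$ is $(f(S_i))_{i\ge 0}$. Two functions $f,g:\{-1,1\}^n\to\{-1,1\}$ are isomorphic if there is a graph automorphism $\psi$ of the hypercube with $f\circ\psi=g$. *)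

theory Defs
  imports "HOL-Probability.Probability"
begin

definition cube :: "nat \<Rightarrow> (nat \<Rightarrow> int) set" where
  "cube n = {..<n} \<rightarrow>\<^sub>E {-1, 1}"

definition cube_adj :: "nat \<Rightarrow> (nat \<Rightarrow> int) \<Rightarrow> (nat \<Rightarrow> int) \<Rightarrow> bool" where
  "cube_adj n x y \<longleftrightarrow> x \<in> cube n \<and> y \<in> cube n \<and> (\<exists>!i. i < n \<and> x i \<noteq> y i)"

definition cube_neighbors :: "nat \<Rightarrow> (nat \<Rightarrow> int) \<Rightarrow> (nat \<Rightarrow> int) set" where
  "cube_neighbors n x = {y. cube_adj n x y}"

definition cube_automorphism :: "nat \<Rightarrow> ((nat \<Rightarrow> int) \<Rightarrow> (nat \<Rightarrow> int)) \<Rightarrow> bool" where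
  "cube_automorphism n \<psi> \<longleftrightarrow>
     bij_betw \<psi> (cube n) (cube n) \<and>
     (\<forall>x\<in>cube n. \<forall>y\<in>cube n. cube_adj n (\<psi> x) (\<psi> y) \<longleftrightarrow> cube_adj n x y)"

definition sceneries :: "nat \<Rightarrow> ((nat \<Rightarrow> int) \<Rightarrow> int) set" where
  "sceneries n = cube n \<rightarrow>\<^sub>E {-1, 1}"

definition isomorphic_sceneries ::
    "nat \<Rightarrow> ((nat \<Rightarrow> int) \<Rightarrow> int) \<Rightarrow> ((nat \<Rightarrow> int) \<Rightarrow> int) \<Rightarrow> bool" where
  "isomorphic_sceneries n f g \<longleftrightarrow>
     (\<exists>\<psi>. cube_automorphism n \<psi> \<and> (\<forall>x\<in>cube n. f (\<psi> x) = g x))"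

text \<open>
  Simple random walk on an arbitrary probability space \<open>M\<close>. The last clause is the
  conditional law of the next step given the entire past; only trajectories \<open>x\<close> with
  positive probability are constrained.
\<close>

definition simple_random_walk ::
    "nat \<Rightarrow> 'a measure \<Rightarrow> (nat \<Rightarrow> 'a \<Rightarrow> (nat \<Rightarrow> int)) \<Rightarrow> bool" where
  "simple_random_walk n M S \<longleftrightarrow>
     prob_space M \<and>
     (\<forall>i. S i \<in> M \<rightarrow>\<^sub>M count_space (cube n)) \<and>
     (\<forall>x\<in>cube n. \<P>(\<omega> in M. S 0 \<omega> = x) = 1 / real (card (cube n))) \<and>
     (\<forall>k x y. \<P>(\<omega> in M. \<forall>i\<le>k. S i \<omega> = x i) > 0 \<longrightarrow>
        \<P>(\<omega> in M. S (Suc k) \<omega> = y \<bar> \<forall>i\<le>k. S i \<omega> = x i) =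
          (if y \<in> cube_neighbors n (x k) then 1 / real (card (cube_neighbors n (x k))) else 0))"

definition sign_sequences :: "(nat \<Rightarrow> int) measure" where
  "sign_sequences = (\<Pi>\<^sub>M i\<in>UNIV. count_space {-1, 1})"

end

theory Submission
  imports Defs
begin

text \<open>
  Two colorings of the cube can produce scenery processes with the same law although no automorphism
  carries one to the other; a reconstruction map would then have to return, on the same sequences, a
  function isomorphic to both.

  The source of equal laws is balance: if every vertex has as many neighbors colored \<open>1\<close> as neighbors
  colored \<open>-1\<close>, then each new color is a fair sign, whatever trajectory led there. A double count of
  the edges shows that the coloring as a whole is then fair too, so the first color is a fair sign as
  well, and the scenery is a sequence of independent fair coin tosses (\<open>prob_colors\<close>). All balanced
  colorings of one cube therefore share one law (\<open>balanced_same_law\<close>).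

  Balanced colorings are the sign-valued functions in the kernel of the adjacency operator. That kernel
  is spanned by the products of exactly \<open>n div 2\<close> coordinates, \<open>n\<close> being even: flipping a coordinate
  inside the product changes its sign, flipping one outside does not, and there are equally many of
  each. One such product is the coloring \<open>monomial\<close>. The other coloring, \<open>switch\<close>, is a combination
  of four products, chosen so that its values are still signs.

  The two are told apart by four-cycles. Around each four-cycle the values of \<open>monomial\<close> multiply to
  \<open>1\<close>, because opposite edges flip the same coordinate and so change the sign together. Automorphisms
  preserve this property (\<open>positive_cycles_isomorphic\<close>), and \<open>switch\<close> violates it on a four-cycle
  through the all-ones vertex.
\<close>

section \<open>Neighbors in the cube\<close>

definition flip :: "nat \<Rightarrow> (nat \<Rightarrow> int) \<Rightarrow> (nat \<Rightarrow> int)" where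
  "flip i x = x(i := - x i)"

lemma finite_cube [simp]: "finite (cube n)"
  unfolding cube_def by (intro finite_PiE) auto

lemma cube_nonempty: "cube n \<noteq> {}"
  unfolding cube_def by (auto simp: PiE_eq_empty_iff)

lemma cube_coord: "x \<in> cube n \<Longrightarrow> i < n \<Longrightarrow> x i = -1 \<or> x i = 1"
  unfolding cube_def by auto

lemma flip_in_cube: "x \<in> cube n \<Longrightarrow> i < n \<Longrightarrow> flip i x \<in> cube n"
  unfolding cube_def flip_def by (auto simp: PiE_iff extensional_def)

lemma cube_adj_iff_flip:
  assumes "x \<in> cube n"
  shows "cube_adj n x y \<longleftrightarrow> (\<exists>i<n. y = flip i x)"
proof
  assume adj: "cube_adj n x y"
  then obtain i where i: "i < n" "x i \<noteq> y i" "\<And>j. j < n \<Longrightarrow> x j \<noteq> y j \<Longrightarrow> j = i"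
    and y: "y \<in> cube n"
    unfolding cube_adj_def by (elim conjE ex1E) blast
  have "y j = flip i x j" for j
  proof (cases "j < n")
    case True
    show ?thesis
    proof (cases "j = i")
      case True
      then show ?thesis
        using i(2) cube_coord[OF assms i(1)] cube_coord[OF y i(1)] unfolding flip_def by auto
    next
      case False
      then have "x j = y j" using i(3)[OF True] by blast
      with False show ?thesis unfolding flip_def by simp
    qed
  next
    case False
    then show ?thesis
      using PiE_arb[OF assms[unfolded cube_def]] PiE_arb[OF y[unfolded cube_def]] i(1)
      unfolding flip_def by auto
  qed
  then show "\<exists>i<n. y = flip i x" using i(1) by blast
next
  assume "\<exists>i<n. y = flip i x"
  then obtain i where i: "i < n" "y = flip i x" by blast
  have "x i \<noteq> y i"
    using i cube_coord[OF assms i(1)] by (auto simp: flip_def)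
  moreover have "j = i" if "x j \<noteq> y j" for j
    using that i by (auto simp: flip_def split: if_splits)
  ultimately have "\<exists>!i. i < n \<and> x i \<noteq> y i" using i(1) by (intro ex1I[of _ i]) blast+
  then show "cube_adj n x y"
    unfolding cube_adj_def using assms flip_in_cube[OF assms i(1)] i(2) by blast
qed

lemma cube_adj_sym: "cube_adj n x y \<longleftrightarrow> cube_adj n y x"
  unfolding cube_adj_def by metis

lemma cube_adj_in_cube:
  assumes "cube_adj n x y"
  shows "x \<in> cube n" "y \<in> cube n"
  using assms unfolding cube_adj_def by simp_all

lemma cube_neighbors_eq:
  "x \<in> cube n \<Longrightarrow> cube_neighbors n x = (\<lambda>i. flip i x) ` {..<n}"
  unfolding cube_neighbors_def by (auto simp: cube_adj_iff_flip)

lemma cube_neighbors_subset: "cube_neighbors n x \<subseteq> cube n"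
  unfolding cube_neighbors_def by (auto dest: cube_adj_in_cube)

lemma flip_inj_on:
  assumes "x \<in> cube n"
  shows "inj_on (\<lambda>i. flip i x) {..<n}"
proof (rule inj_onI)
  fix i j assume *: "i \<in> {..<n}" "j \<in> {..<n}" "flip i x = flip j x"
  from fun_cong[OF *(3), of i] show "i = j"
    using cube_coord[OF assms, of i] * by (auto simp: flip_def split: if_splits)
qed

lemma sum_cube_neighbors:
  "x \<in> cube n \<Longrightarrow> (\<Sum>y\<in>cube_neighbors n x. g y) = (\<Sum>i<n. g (flip i x))"
  by (simp add: cube_neighbors_eq sum.reindex[OF flip_inj_on])

lemma card_cube_neighbors: "x \<in> cube n \<Longrightarrow> card (cube_neighbors n x) = n"
  by (simp add: cube_neighbors_eq card_image[OF flip_inj_on])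

section \<open>Balanced sceneries look like fair coin tosses\<close>

text \<open>
  For sign-valued \<open>f\<close>, a vanishing sum over the neighbors says that half of them carry each sign.
\<close>

definition balanced :: "nat \<Rightarrow> ((nat \<Rightarrow> int) \<Rightarrow> int) \<Rightarrow> bool" where
  "balanced n f \<longleftrightarrow> f \<in> sceneries n \<and> (\<forall>x\<in>cube n. (\<Sum>y\<in>cube_neighbors n x. f y) = 0)"

text \<open>The probability that a uniformly random sign lies in \<open>B\<close>.\<close>

definition coin :: "int set \<Rightarrow> real" where
  "coin B = (indicator B 1 + indicator B (-1)) / 2"

text \<open>
  Every function on two points is affine, so averages of \<open>indicator B (f y)\<close> are determined by
  averages of \<open>f y\<close>. This turns the vanishing sums in \<open>balanced\<close> into probabilities.
\<close>

lemma indicator_sign_affine: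
  "v = -1 \<or> v = 1 \<Longrightarrow>
   indicator B v = coin B + (indicator B 1 - indicator B (-1)) / 2 * real_of_int v"
  unfolding coin_def by (auto simp: field_simps)

lemma sceneries_sign: "f \<in> sceneries n \<Longrightarrow> x \<in> cube n \<Longrightarrow> f x = -1 \<or> f x = 1"
  unfolding sceneries_def by auto

lemma sum_indicator_sum_zero:
  assumes "f \<in> sceneries n" "A \<subseteq> cube n" "(\<Sum>y\<in>A. f y) = 0"
  shows "(\<Sum>y\<in>A. indicator B (f y)) = real (card A) * coin B"
proof -
  let ?d = "(indicator B 1 - indicator B (-1)) / 2 :: real"
  have "(\<Sum>y\<in>A. indicator B (f y)) = (\<Sum>y\<in>A. coin B + ?d * real_of_int (f y))"
    using assms by (intro sum.cong refl indicator_sign_affine sceneries_sign) auto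
  also have "\<dots> = real (card A) * coin B + ?d * real_of_int (\<Sum>y\<in>A. f y)"
    by (simp add: sum.distrib sum_distrib_left)
  finally show ?thesis using assms(3) by simp
qed

text \<open>
  Each vertex is a neighbor of exactly \<open>n\<close> vertices, so adding up the sums over all
  neighborhoods gives \<open>n\<close> times the total.
\<close>

lemma balanced_sum_zero:
  assumes "balanced n f" "n > 0"
  shows "(\<Sum>x\<in>cube n. f x) = 0"
proof -
  have "0 = (\<Sum>x\<in>cube n. \<Sum>y\<in>cube_neighbors n x. f y)"
    using assms(1) unfolding balanced_def by simp
  also have "\<dots> = (\<Sum>x\<in>cube n. \<Sum>y | y \<in> cube n \<and> cube_adj n x y. f y)"
    unfolding cube_neighbors_def by (intro sum.cong refl) (auto dest: cube_adj_in_cube)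
  also have "\<dots> = (\<Sum>y\<in>cube n. \<Sum>x | x \<in> cube n \<and> cube_adj n x y. f y)"
    by (rule sum.swap_restrict) auto
  also have "\<dots> = (\<Sum>y\<in>cube n. int n * f y)"
  proof (intro sum.cong refl)
    fix y assume y: "y \<in> cube n"
    have "{x. x \<in> cube n \<and> cube_adj n x y} = cube_neighbors n y"
      unfolding cube_neighbors_def using cube_adj_sym[of n _ y] cube_adj_in_cube by blast
    then show "(\<Sum>x | x \<in> cube n \<and> cube_adj n x y. f y) = int n * f y"
      using card_cube_neighbors[OF y] by simp
  qed
  also have "\<dots> = int n * (\<Sum>y\<in>cube n. f y)"
    by (simp add: sum_distrib_left)
  finally show ?thesis using assms(2) by simp
qed

locale cube_walk = prob_space M for M :: "'a measure" +
  fixes n :: nat and S :: "nat \<Rightarrow> 'a \<Rightarrow> (nat \<Rightarrow> int)"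
  assumes walk: "simple_random_walk n M S"
    and dim_pos: "n > 0"
begin

lemma walk_measurable [measurable]: "S i \<in> M \<rightarrow>\<^sub>M count_space (cube n)"
  using walk unfolding simple_random_walk_def by blast

lemma walk_in_cube: "\<omega> \<in> space M \<Longrightarrow> S i \<omega> \<in> cube n"
  using measurable_space[OF walk_measurable] by simp

lemma walk_event [measurable]: "{\<omega> \<in> space M. P (S i \<omega>)} \<in> sets M"
proof -
  have "{\<omega> \<in> space M. P (S i \<omega>)} = S i -` {x \<in> cube n. P x} \<inter> space M"
    using walk_in_cube by auto
  also have "\<dots> \<in> sets M" by (rule measurable_sets[OF walk_measurable]) auto
  finally show ?thesis .
qed

lemma past_event [measurable]: "{\<omega> \<in> space M. \<forall>i\<le>k. P i (S i \<omega>)} \<in> sets M"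
proof -
  have "{\<omega> \<in> space M. \<forall>i\<le>(k::nat). P i (S i \<omega>)} = (\<Inter>i\<le>k. {\<omega> \<in> space M. P i (S i \<omega>)})"
    by auto
  then show ?thesis by auto
qed

lemma step_event [measurable]:
  "{\<omega> \<in> space M. (\<forall>i\<le>k. P i (S i \<omega>)) \<and> Q (S j \<omega>)} \<in> sets M"
proof -
  have "{\<omega> \<in> space M. (\<forall>i\<le>(k::nat). P i (S i \<omega>)) \<and> Q (S j \<omega>)}
      = {\<omega> \<in> space M. \<forall>i\<le>k. P i (S i \<omega>)} \<inter> {\<omega> \<in> space M. Q (S j \<omega>)}"
    by auto
  then show ?thesis using past_event walk_event by auto
qed

text \<open>
  The transition rule without conditioning: it also covers trajectories of probability zero, where
  both sides vanish.
\<close>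

lemma prob_step:
  "\<P>(\<omega> in M. (\<forall>i\<le>k. S i \<omega> = x i) \<and> S (Suc k) \<omega> = y) =
   \<P>(\<omega> in M. \<forall>i\<le>k. S i \<omega> = x i) * indicator (cube_neighbors n (x k)) y / n"
proof (cases "\<P>(\<omega> in M. \<forall>i\<le>k. S i \<omega> = x i) > 0")
  case True
  then obtain \<omega> where "\<omega> \<in> space M" "S k \<omega> = x k"
    using measure_empty[of M] by (metis (mono_tags, lifting) Collect_empty_eq less_irrefl order_refl)
  then have xk: "x k \<in> cube n" using walk_in_cube by metis
  have "\<P>(\<omega> in M. S (Suc k) \<omega> = y \<bar> \<forall>i\<le>k. S i \<omega> = x i) =
      (if y \<in> cube_neighbors n (x k) then 1 / real (card (cube_neighbors n (x k))) else 0)"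
    using walk True unfolding simple_random_walk_def by blast
  then have "\<P>(\<omega> in M. S (Suc k) \<omega> = y \<and> (\<forall>i\<le>k. S i \<omega> = x i)) =
      \<P>(\<omega> in M. \<forall>i\<le>k. S i \<omega> = x i) * (indicator (cube_neighbors n (x k)) y / n)"
    using True unfolding cond_prob_def card_cube_neighbors[OF xk]
    by (auto simp: field_simps split: if_splits)
  then show ?thesis by (simp add: conj_commute)
next
  case False
  then have 0: "\<P>(\<omega> in M. \<forall>i\<le>k. S i \<omega> = x i) = 0"
    by (simp add: zero_less_measure_iff)
  have "\<P>(\<omega> in M. (\<forall>i\<le>k. S i \<omega> = x i) \<and> S (Suc k) \<omega> = y) \<le> \<P>(\<omega> in M. \<forall>i\<le>k. S i \<omega> = x i)"
    by (intro finite_measure_mono past_event) auto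
  then show ?thesis using 0 by (simp add: measure_le_0_iff)
qed

text \<open>
  The next color is independent of the entire trajectory, and hence of the colors seen so far.
\<close>

lemma prob_next_color:
  assumes f: "balanced n f"
  shows "\<P>(\<omega> in M. (\<forall>i\<le>k. S i \<omega> = x i) \<and> f (S (Suc k) \<omega>) \<in> B) =
         \<P>(\<omega> in M. \<forall>i\<le>k. S i \<omega> = x i) * coin B"
proof (cases "x k \<in> cube n")
  case True
  let ?P = "\<P>(\<omega> in M. \<forall>i\<le>k. S i \<omega> = x i)"
  let ?N = "cube_neighbors n (x k)"
  have "\<P>(\<omega> in M. (\<forall>i\<le>k. S i \<omega> = x i) \<and> f (S (Suc k) \<omega>) \<in> B)
      = measure M (\<Union>y\<in>{y\<in>cube n. f y \<in> B}.
          {\<omega> \<in> space M. (\<forall>i\<le>k. S i \<omega> = x i) \<and> S (Suc k) \<omega> = y})"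
    using walk_in_cube by (intro arg_cong[where f="measure M"]) auto
  also have "\<dots> = (\<Sum>y\<in>{y\<in>cube n. f y \<in> B}.
      \<P>(\<omega> in M. (\<forall>i\<le>k. S i \<omega> = x i) \<and> S (Suc k) \<omega> = y))"
    by (intro finite_measure_finite_Union) (auto simp: disjoint_family_on_def intro!: step_event)
  also have "\<dots> = (\<Sum>y\<in>{y\<in>cube n. f y \<in> B}. ?P / n * indicator ?N y)"
    by (simp add: prob_step)
  also have "\<dots> = (\<Sum>y\<in>cube n. ?P / n * (indicator ?N y * indicator B (f y)))"
    by (rule sum.mono_neutral_cong_left) auto
  also have "\<dots> = ?P / n * (\<Sum>y\<in>cube n. indicator ?N y * indicator B (f y))"
    by (simp only: sum_distrib_left)
  also have "(\<Sum>y\<in>cube n. indicator ?N y * indicator B (f y) :: real) = (\<Sum>y\<in>?N. indicator B (f y))"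
    by (rule sum.mono_neutral_cong_right) (use cube_neighbors_subset in auto)
  also have "\<dots> = n * coin B"
    using f True sum_indicator_sum_zero[OF _ cube_neighbors_subset, of f n "x k" B]
    unfolding balanced_def by (simp add: card_cube_neighbors)
  finally show ?thesis using dim_pos by simp
next
  case False
  then have off: "S k \<omega> \<noteq> x k" if "\<omega> \<in> space M" for \<omega>
    using walk_in_cube[OF that, of k] by auto
  have "{\<omega> \<in> space M. \<forall>i\<le>k. S i \<omega> = x i} = {}"
    using off by blast
  moreover from this have "{\<omega> \<in> space M. (\<forall>i\<le>k. S i \<omega> = x i) \<and> f (S (Suc k) \<omega>) \<in> B} = {}"
    by blast
  ultimately show ?thesis by (simp only: measure_empty mult_zero_left)
qed

text \<open>
  The sets \<open>A i\<close> are arbitrary so that \<open>UNIV\<close> can stand at the times left free by a cylinder event.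
\<close>

lemma prob_colors:
  assumes f: "balanced n f"
  shows "\<P>(\<omega> in M. \<forall>i\<le>k. f (S i \<omega>) \<in> A i) = (\<Prod>i\<le>k. coin (A i))"
proof (induction k)
  case 0
  have fs: "f \<in> sceneries n" using f unfolding balanced_def by blast
  have "\<P>(\<omega> in M. f (S 0 \<omega>) \<in> A 0)
      = measure M (\<Union>x\<in>{x\<in>cube n. f x \<in> A 0}. {\<omega> \<in> space M. S 0 \<omega> = x})"
    using walk_in_cube by (intro arg_cong[where f="measure M"]) auto
  also have "\<dots> = (\<Sum>x\<in>{x\<in>cube n. f x \<in> A 0}. \<P>(\<omega> in M. S 0 \<omega> = x))"
    by (intro finite_measure_finite_Union) (auto simp: disjoint_family_on_def intro!: walk_event)
  also have "\<dots> = (\<Sum>x\<in>{x\<in>cube n. f x \<in> A 0}. 1 / card (cube n))"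
    using walk unfolding simple_random_walk_def by (intro sum.cong refl) auto
  also have "\<dots> = (\<Sum>x\<in>cube n. indicator (A 0) (f x) / card (cube n))"
    by (rule sum.mono_neutral_cong_left) auto
  also have "\<dots> = (\<Sum>x\<in>cube n. indicator (A 0) (f x)) / card (cube n)"
    by (simp only: sum_divide_distrib)
  also have "\<dots> = coin (A 0)"
    using sum_indicator_sum_zero[OF fs order_refl balanced_sum_zero[OF f dim_pos], of "A 0"]
      cube_nonempty[of n] by simp
  finally show ?case by simp
next
  case (Suc k)
  \<comment> \<open>The law of the next step is known only given the positions, not given the colors, so an event
    about past colors is split according to the trajectories that realize it.\<close>
  define T where "T = {x \<in> {..k} \<rightarrow>\<^sub>E cube n. \<forall>i\<le>k. f (x i) \<in> A i}"
  have finT: "finite T" unfolding T_def by (simp add: finite_PiE)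
  have decomp: "\<P>(\<omega> in M. (\<forall>i\<le>k. f (S i \<omega>) \<in> A i) \<and> Q (S (Suc k) \<omega>)) =
      (\<Sum>x\<in>T. \<P>(\<omega> in M. (\<forall>i\<le>k. S i \<omega> = x i) \<and> Q (S (Suc k) \<omega>)))" for Q
  proof -
    have "{\<omega> \<in> space M. (\<forall>i\<le>k. f (S i \<omega>) \<in> A i) \<and> Q (S (Suc k) \<omega>)} =
        (\<Union>x\<in>T. {\<omega> \<in> space M. (\<forall>i\<le>k. S i \<omega> = x i) \<and> Q (S (Suc k) \<omega>)})" (is "?L = ?R")
    proof (intro equalityI subsetI)
      fix \<omega> assume \<omega>: "\<omega> \<in> ?L"
      then have "(\<lambda>i\<in>{..k}. S i \<omega>) \<in> T" unfolding T_def using walk_in_cube by auto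
      with \<omega> show "\<omega> \<in> ?R" by (intro UN_I[of "\<lambda>i\<in>{..k}. S i \<omega>"]) auto
    qed (auto simp: T_def)
    moreover have "measure M ?R = (\<Sum>x\<in>T. \<P>(\<omega> in M. (\<forall>i\<le>k. S i \<omega> = x i) \<and> Q (S (Suc k) \<omega>)))"
    proof (intro finite_measure_finite_Union finT)
      show "disjoint_family_on (\<lambda>x. {\<omega> \<in> space M. (\<forall>i\<le>k. S i \<omega> = x i) \<and> Q (S (Suc k) \<omega>)}) T"
      proof (unfold disjoint_family_on_def, intro ballI impI, rule ccontr)
        fix x y assume xy: "x \<in> T" "y \<in> T" "x \<noteq> y"
          and "{\<omega> \<in> space M. (\<forall>i\<le>k. S i \<omega> = x i) \<and> Q (S (Suc k) \<omega>)} \<inter>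
               {\<omega> \<in> space M. (\<forall>i\<le>k. S i \<omega> = y i) \<and> Q (S (Suc k) \<omega>)} \<noteq> {}"
        then obtain \<omega> where "\<forall>i\<le>k. S i \<omega> = x i" "\<forall>i\<le>k. S i \<omega> = y i" by blast
        then have "x i = y i" if "i \<in> {..k}" for i using that by simp
        with xy PiE_ext[of x "{..k}" "\<lambda>_. cube n" y] show False unfolding T_def by blast
      qed
    qed (auto intro!: step_event)
    ultimately show ?thesis by simp
  qed
  have "\<P>(\<omega> in M. \<forall>i\<le>Suc k. f (S i \<omega>) \<in> A i)
      = \<P>(\<omega> in M. (\<forall>i\<le>k. f (S i \<omega>) \<in> A i) \<and> f (S (Suc k) \<omega>) \<in> A (Suc k))"
    by (intro arg_cong[where f="measure M"]) (auto simp: le_Suc_eq)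
  also have "\<dots> = (\<Sum>x\<in>T. \<P>(\<omega> in M. \<forall>i\<le>k. S i \<omega> = x i)) * coin (A (Suc k))"
    using decomp[of "\<lambda>z. f z \<in> A (Suc k)"]
    by (simp only: prob_next_color[OF f] sum_distrib_right)
  also have "(\<Sum>x\<in>T. \<P>(\<omega> in M. \<forall>i\<le>k. S i \<omega> = x i)) = \<P>(\<omega> in M. \<forall>i\<le>k. f (S i \<omega>) \<in> A i)"
    using decomp[of "\<lambda>_. True"] by simp
  finally show ?case using Suc by simp
qed

lemma scenery_process_measurable:
  assumes "f \<in> sceneries n"
  shows "(\<lambda>\<omega> i. f (S i \<omega>)) \<in> M \<rightarrow>\<^sub>M sign_sequences"
  unfolding sign_sequences_def
proof (rule measurable_PiM_single')
  fix i :: nat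
  have "f \<in> count_space (cube n) \<rightarrow>\<^sub>M count_space {-1, 1}"
    using assms unfolding sceneries_def by (auto simp: measurable_count_space_eq1)
  then show "(\<lambda>\<omega>. f (S i \<omega>)) \<in> M \<rightarrow>\<^sub>M count_space {-1, 1}"
    by (rule measurable_compose[OF walk_measurable])
next
  show "(\<lambda>\<omega> i. f (S i \<omega>)) \<in> space M \<rightarrow> (\<Pi>\<^sub>E i\<in>UNIV. space (count_space {-1, 1}))"
    using sceneries_sign[OF assms] walk_in_cube by (fastforce simp: PiE_iff)
qed

text \<open>
  A law on sequences is determined by its values on cylinders, and those values do not involve the
  coloring.
\<close>

lemma balanced_same_law:
  assumes f: "balanced n f" and g: "balanced n g"
  shows "distr M sign_sequences (\<lambda>\<omega> i. f (S i \<omega>)) = distr M sign_sequences (\<lambda>\<omega> i. g (S i \<omega>))"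
proof -
  let ?C = "\<lambda>_::nat. count_space {-1, 1 :: int}"
  \<comment> \<open>The element \<open>0\<close> only keeps the maximum defined when \<open>J\<close> is empty.\<close>
  have cylinder: "emeasure (distr M sign_sequences (\<lambda>\<omega> i. h (S i \<omega>))) (prod_emb UNIV ?C J (Pi\<^sub>E J A))
      = (\<Prod>i\<le>Max (insert 0 J). coin (if i \<in> J then A i else UNIV))"
    if h: "balanced n h" and J: "finite J" and A: "\<And>i. i \<in> J \<Longrightarrow> A i \<in> sets (?C i)"
    for h J A
  proof -
    have hs: "h \<in> sceneries n" using h unfolding balanced_def by blast
    let ?k = "Max (insert 0 J)"
    have "prod_emb UNIV ?C J (Pi\<^sub>E J A) \<in> sets sign_sequences"
      unfolding sign_sequences_def using J A by (intro sets_PiM_I) auto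
    then have "emeasure (distr M sign_sequences (\<lambda>\<omega> i. h (S i \<omega>))) (prod_emb UNIV ?C J (Pi\<^sub>E J A))
      = emeasure M ((\<lambda>\<omega> i. h (S i \<omega>)) -` prod_emb UNIV ?C J (Pi\<^sub>E J A) \<inter> space M)"
      by (intro emeasure_distr scenery_process_measurable hs)
    also have "(\<lambda>\<omega> i. h (S i \<omega>)) -` prod_emb UNIV ?C J (Pi\<^sub>E J A) \<inter> space M =
        {\<omega> \<in> space M. \<forall>i\<le>?k. h (S i \<omega>) \<in> (if i \<in> J then A i else UNIV)}" (is "?L = ?R")
    proof -
      have "i \<le> ?k" if "i \<in> J" for i using J that by simp
      then have "\<omega> \<in> ?L \<longleftrightarrow> \<omega> \<in> ?R" for \<omega>
        using sceneries_sign[OF hs walk_in_cube, of \<omega>]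
        unfolding prod_emb_def by (fastforce simp: PiE_iff restrict_apply)
      then show ?thesis by blast
    qed
    also have "emeasure M \<dots> = ennreal (\<Prod>i\<le>?k. coin (if i \<in> J then A i else UNIV))"
      unfolding emeasure_eq_measure by (subst prob_colors[OF h]) simp
    finally show ?thesis .
  qed
  show ?thesis
  proof (rule measure_eqI_PiM_infinite[where I=UNIV and M="?C"])
    show "finite_measure (distr M sign_sequences (\<lambda>\<omega> i. f (S i \<omega>)))"
      using f unfolding balanced_def
      by (intro prob_space.finite_measure prob_space_distr scenery_process_measurable) auto
  qed (auto simp: cylinder[OF f] cylinder[OF g] simp flip: sign_sequences_def)
qed

end

section \<open>Products around four-cycles\<close>

text \<open>
  Both inequalities matter: they exclude the closed walks of length four that run back along an edge.
\<close>

definition four_cycle :: "nat \<Rightarrow> (nat \<Rightarrow> int) \<Rightarrow> (nat \<Rightarrow> int) \<Rightarrow> (nat \<Rightarrow> int) \<Rightarrow> (nat \<Rightarrow> int) \<Rightarrow> bool"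
  where "four_cycle n a b c d \<longleftrightarrow>
    cube_adj n a b \<and> cube_adj n b c \<and> cube_adj n c d \<and> cube_adj n d a \<and> a \<noteq> c \<and> b \<noteq> d"

definition positive_cycles :: "nat \<Rightarrow> ((nat \<Rightarrow> int) \<Rightarrow> int) \<Rightarrow> bool" where
  "positive_cycles n f \<longleftrightarrow> (\<forall>a b c d. four_cycle n a b c d \<longrightarrow> f a * f b * f c * f d = 1)"

lemma isomorphic_sceneries_sym:
  assumes "isomorphic_sceneries n f g"
  shows "isomorphic_sceneries n g f"
proof -
  from assms obtain \<psi> where bij: "bij_betw \<psi> (cube n) (cube n)"
    and adj: "\<forall>x\<in>cube n. \<forall>y\<in>cube n. cube_adj n (\<psi> x) (\<psi> y) \<longleftrightarrow> cube_adj n x y"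
    and eq: "\<forall>x\<in>cube n. f (\<psi> x) = g x"
    unfolding isomorphic_sceneries_def cube_automorphism_def by blast
  let ?\<phi> = "inv_into (cube n) \<psi>"
  have bij': "bij_betw ?\<phi> (cube n) (cube n)" by (rule bij_betw_inv_into[OF bij])
  have in': "?\<phi> x \<in> cube n" if "x \<in> cube n" for x using bij' that by (auto dest: bij_betwE)
  have inv: "\<psi> (?\<phi> x) = x" if "x \<in> cube n" for x
    using bij_betw_inv_into_right[OF bij that] .
  have "cube_adj n (?\<phi> x) (?\<phi> y) \<longleftrightarrow> cube_adj n x y" if "x \<in> cube n" "y \<in> cube n" for x y
    using adj in' inv that by metis
  moreover have "g (?\<phi> x) = f x" if "x \<in> cube n" for x
    using eq in' inv that by metis
  ultimately show ?thesis
    unfolding isomorphic_sceneries_def cube_automorphism_def using bij' by blast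
qed

lemma positive_cycles_isomorphic:
  assumes iso: "isomorphic_sceneries n f g" and pos: "positive_cycles n f"
  shows "positive_cycles n g"
  unfolding positive_cycles_def
proof (intro allI impI)
  fix a b c d assume cyc: "four_cycle n a b c d"
  then have abcd: "a \<in> cube n" "b \<in> cube n" "c \<in> cube n" "d \<in> cube n"
    unfolding four_cycle_def by (auto dest: cube_adj_in_cube)
  from iso obtain \<psi> where inj: "inj_on \<psi> (cube n)"
    and adj: "\<And>x y. x\<in>cube n \<Longrightarrow> y\<in>cube n \<Longrightarrow> cube_adj n (\<psi> x) (\<psi> y) \<longleftrightarrow> cube_adj n x y"
    and eq: "\<And>x. x\<in>cube n \<Longrightarrow> f (\<psi> x) = g x"
    unfolding isomorphic_sceneries_def cube_automorphism_def by (auto dest: bij_betw_imp_inj_on)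
  have "four_cycle n (\<psi> a) (\<psi> b) (\<psi> c) (\<psi> d)"
    using cyc abcd adj inj unfolding four_cycle_def by (auto simp: inj_on_eq_iff)
  then have "f (\<psi> a) * f (\<psi> b) * f (\<psi> c) * f (\<psi> d) = 1"
    using pos unfolding positive_cycles_def by blast
  then show "g a * g b * g c * g d = 1" by (simp add: eq abcd)
qed

section \<open>Two balanced sceneries\<close>

definition monomial :: "nat \<Rightarrow> (nat \<Rightarrow> int) \<Rightarrow> int" where
  "monomial n = (\<lambda>x\<in>cube n. \<Prod>i<n div 2. x i)"

text \<open>
  On signs, \<open>x 0 * (if x 0 = x 1 then x 2 else x 3)\<close> equals
  \<open>(x 0 * x 2 + x 1 * x 2 + x 0 * x 3 - x 1 * x 3) / 2\<close>, so \<open>switch\<close> is a linear combination of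
  products of \<open>n div 2\<close> coordinates. The remaining \<open>n div 2 - 2\<close> factors only raise the degree from
  \<open>2\<close>, the value that balances the case \<open>n = 4\<close>, to \<open>n div 2\<close>.
\<close>

definition switch :: "nat \<Rightarrow> (nat \<Rightarrow> int) \<Rightarrow> int" where
  "switch n = (\<lambda>x\<in>cube n.
     x 0 * (if x 0 = x 1 then x 2 else x 3) * (\<Prod>i=4..<n div 2 + 2. x i))"

lemma prod_sign:
  assumes "x \<in> cube n" "I \<subseteq> {..<n}"
  shows "(\<Prod>i\<in>I. x i) = -1 \<or> (\<Prod>i\<in>I. x i) = 1"
proof -
  have "finite I" using assms(2) finite_subset by blast
  then show ?thesis using assms(2)
    by (induction I) (use cube_coord[OF assms(1)] in \<open>auto simp: subset_iff\<close>, fastforce+)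
qed

lemma prod_flip:
  assumes "finite I"
  shows "(\<Prod>j\<in>I. flip i x j) = (if i \<in> I then -1 else 1) * (\<Prod>j\<in>I. x j)"
proof (cases "i \<in> I")
  case True
  then have "(\<Prod>j\<in>I. flip i x j) = flip i x i * (\<Prod>j\<in>I - {i}. x j)"
    using assms by (subst prod.remove[of I i]) (auto simp: flip_def intro!: prod.cong)
  then show ?thesis using True assms by (simp add: flip_def prod.remove[of I i x])
qed (auto simp: flip_def intro!: prod.cong)

lemma monomial_flip:
  assumes "x \<in> cube n" "i < n"
  shows "monomial n (flip i x) = (if i < n div 2 then -1 else 1) * monomial n x"
  using assms flip_in_cube[OF assms] by (simp add: monomial_def prod_flip)

lemma monomial_balanced:
  assumes "even n"
  shows "balanced n (monomial n)"
  unfolding balanced_def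
proof (intro conjI ballI)
  have "(\<Prod>i<n div 2. x i) \<in> {-1, 1}" if "x \<in> cube n" for x
    using prod_sign[OF that, of "{..<n div 2}"] by auto
  then show "monomial n \<in> sceneries n" unfolding sceneries_def monomial_def by (simp add: Pi_iff)
  fix x assume x: "x \<in> cube n"
  obtain m where m: "n = 2 * m" using assms by auto
  have "{..<n} = {..<m} \<union> {m..<n}" using m by auto
  then have "(\<Sum>i<n. if i < m then -1 else 1 :: int) = 0"
    using m by (simp add: sum.union_disjoint ivl_disj_int)
  then show "(\<Sum>y\<in>cube_neighbors n x. monomial n y) = 0"
    using x m by (simp add: sum_cube_neighbors monomial_flip flip: sum_distrib_right)
qed

lemma sign_mult: "a \<in> {-1, 1} \<Longrightarrow> b \<in> {-1, 1} \<Longrightarrow> a * b \<in> {-1, 1 :: int}"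
  by auto

text \<open>
  Among the flips of the first four coordinates, those of \<open>0\<close> and \<open>1\<close> lead to opposite values, since
  both change the selected coordinate to the same one but only the first changes the sign of \<open>x 0\<close>.
  Of the flips of \<open>2\<close> and \<open>3\<close>, exactly the one of the selected coordinate changes the sign. Of the other
  \<open>n - 4\<close> coordinates, the \<open>n div 2 - 2\<close> in the tail product change the sign and equally many do not.
\<close>

lemma switch_balanced:
  assumes "even n" "n \<ge> 4"
  shows "balanced n (switch n)"
  unfolding balanced_def
proof (intro conjI ballI)
  have "x 0 * (if x 0 = x 1 then x 2 else x 3) * (\<Prod>i=4..<n div 2 + 2. x i) \<in> {-1, 1}"
    if "x \<in> cube n" for x
  proof (intro sign_mult)
    show "x 0 \<in> {-1, 1}" using cube_coord[OF that, of 0] assms by simp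
    show "(if x 0 = x 1 then x 2 else x 3) \<in> {-1, 1}"
      using cube_coord[OF that, of 2] cube_coord[OF that, of 3] assms by simp
    show "(\<Prod>i=4..<n div 2 + 2. x i) \<in> {-1, 1}"
    proof -
      have "n div 2 + 2 \<le> n" using assms(2) by linarith
      then have "{4..<n div 2 + 2} \<subseteq> {..<n}" by (simp add: subset_iff)
      from prod_sign[OF that this] show ?thesis by blast
    qed
  qed
  then show "switch n \<in> sceneries n" unfolding sceneries_def switch_def by (simp add: Pi_iff)
  fix x assume x: "x \<in> cube n"
  obtain m where m: "n = 2 * m" "m \<ge> 2" using assms by auto
  let ?q = "\<lambda>x::nat\<Rightarrow>int. x 0 * (if x 0 = x 1 then x 2 else x 3)"
  let ?p = "\<lambda>x::nat\<Rightarrow>int. \<Prod>i=4..<m+2. x i"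
  have sw: "switch n (flip i x) = ?q (flip i x) * ((if i \<in> {4..<m+2} then -1 else 1) * ?p x)"
    if "i < n" for i
  proof -
    have "n div 2 = m" using m(1) by simp
    then show ?thesis
      by (simp only: switch_def restrict_apply'[OF flip_in_cube[OF x that]]
          prod_flip[OF finite_atLeastLessThan])
  qed
  have q0: "(\<Sum>i<4. ?q (flip i x)) = 0"
    using cube_coord[OF x, of 0] cube_coord[OF x, of 1] assms(2)
    by (auto simp: numeral_eq_Suc flip_def)
  have split: "{..<n} = {..<4} \<union> ({4..<m+2} \<union> {m+2..<n})" using m by auto
  have "(\<Sum>y\<in>cube_neighbors n x. switch n y) =
      (\<Sum>i<n. ?q (flip i x) * ((if i \<in> {4..<m+2} then -1 else 1) * ?p x))"
    using x by (simp add: sum_cube_neighbors sw del: atLeastLessThan_iff)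
  also have "\<dots> = (\<Sum>i<4. ?q (flip i x) * ?p x)
      + ((\<Sum>i=4..<m+2. - (?q x * ?p x)) + (\<Sum>i=m+2..<n. ?q x * ?p x))"
    unfolding split using m
    by (subst sum.union_disjoint, (auto)[3], subst sum.union_disjoint, (auto)[3])
      (intro arg_cong2[where f="(+)"] sum.cong refl; simp add: flip_def)
  also have "\<dots> = (\<Sum>i<4. ?q (flip i x)) * ?p x"
    using m by (simp add: sum_distrib_right)
  finally show "(\<Sum>y\<in>cube_neighbors n x. switch n y) = 0" using q0 by simp
qed

lemma monomial_positive_cycles: "positive_cycles n (monomial n)"
  unfolding positive_cycles_def
proof (intro allI impI)
  fix a b c d assume cyc: "four_cycle n a b c d"
  then have cube: "a \<in> cube n" "b \<in> cube n" "d \<in> cube n"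
    unfolding four_cycle_def by (auto dest: cube_adj_in_cube)
  obtain i where i: "i < n" "b = flip i a"
    using cyc cube cube_adj_iff_flip unfolding four_cycle_def by blast
  obtain j where j: "j < n" "c = flip j b"
    using cyc cube cube_adj_iff_flip unfolding four_cycle_def by blast
  obtain l where l: "l < n" "d = flip l a"
    using cyc cube cube_adj_iff_flip cube_adj_sym unfolding four_cycle_def by metis
  obtain k where k: "k < n" "c = flip k d"
    using cyc cube cube_adj_iff_flip cube_adj_sym unfolding four_cycle_def by metis
  have neq: "i \<noteq> j" "i \<noteq> l"
    using cyc i j l unfolding four_cycle_def by (auto simp: flip_def)
  \<comment> \<open>Opposite edges of a four-cycle flip the same coordinate: otherwise \<open>c\<close> and \<open>a\<close> would differ at
    \<open>l\<close> along the path through \<open>d\<close> and agree there along the path through \<open>b\<close>.\<close>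
  have "l = j"
  proof (rule ccontr)
    assume "l \<noteq> j"
    have "k \<noteq> l" using cyc k l unfolding four_cycle_def by (auto simp: flip_def)
    then have "c l = - a l" using k l by (simp add: flip_def)
    moreover have "c l = a l" using i j neq \<open>l \<noteq> j\<close> by (simp add: flip_def)
    ultimately show False using cube_coord[OF cube(1) l(1)] by auto
  qed
  let ?s = "if j < n div 2 then -1 else 1 :: int"
  have cd: "monomial n c = ?s * monomial n b" "monomial n d = ?s * monomial n a"
    using j l \<open>l = j\<close> cube by (simp_all add: monomial_flip)
  have "monomial n a * monomial n a = 1" "monomial n b * monomial n b = 1"
    using cube prod_sign[of a n "{..<n div 2}"] prod_sign[of b n "{..<n div 2}"]
    by (auto simp: monomial_def)
  then show "monomial n a * monomial n b * monomial n c * monomial n d = 1"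
    unfolding cd by (auto simp: algebra_simps)
qed

text \<open>
  At the all-ones vertex coordinate \<open>2\<close> is selected. Flipping it changes the sign there, but no longer
  does once coordinate \<open>0\<close> is flipped, because coordinate \<open>3\<close> is then selected.
\<close>

lemma switch_not_positive_cycles:
  assumes "n \<ge> 4"
  shows "\<not> positive_cycles n (switch n)"
proof
  assume pos: "positive_cycles n (switch n)"
  define a :: "nat \<Rightarrow> int" where "a = (\<lambda>i\<in>{..<n}. 1)"
  let ?b = "flip 0 a" and ?c = "flip 2 (flip 0 a)" and ?d = "flip 2 a"
  have a_vals: "a 0 = 1" "a 1 = 1" "a 2 = 1" "a 3 = 1" using assms by (simp_all add: a_def)
  have a: "a \<in> cube n" unfolding a_def cube_def by auto
  have b: "?b \<in> cube n" and d: "?d \<in> cube n" using assms by (auto intro!: flip_in_cube a)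
  have c: "?c \<in> cube n" using assms by (auto intro!: flip_in_cube b)
  have c': "?c = flip 0 ?d" by (auto simp: flip_def)
  have "cube_adj n a ?b" "cube_adj n ?b ?c" "cube_adj n a ?d"
    using assms by (auto simp: cube_adj_iff_flip a b intro: exI[of _ 0] exI[of _ 2])
  moreover have "cube_adj n ?d ?c"
    using assms unfolding c' by (auto simp: cube_adj_iff_flip d intro: exI[of _ 0])
  moreover have "a \<noteq> ?c" "?b \<noteq> ?d"
    using a_vals by (auto simp: flip_def fun_eq_iff intro: exI[of _ 0])
  ultimately have "switch n a * switch n ?b * switch n ?c * switch n ?d = 1"
    using pos unfolding positive_cycles_def four_cycle_def by (metis cube_adj_sym)
  moreover have "switch n a * switch n ?b * switch n ?c * switch n ?d = -1"
  proof -
    have "n div 2 + 2 \<le> n" using assms by linarith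
    then have tail: "(\<Prod>i=4..<n div 2 + 2. a i) = 1"
      by (intro prod.neutral) (simp add: a_def)
    note unfold = switch_def prod_flip[OF finite_atLeastLessThan] tail
    have "switch n a = 1"
      by (simp only: unfold restrict_apply'[OF a]) (simp add: a_vals del: One_nat_def)
    moreover have "switch n ?b = -1"
      by (simp only: unfold restrict_apply'[OF b]) (simp add: a_vals flip_def del: One_nat_def)
    moreover have "switch n ?c = -1"
      by (simp only: unfold restrict_apply'[OF c]) (simp add: a_vals flip_def del: One_nat_def)
    moreover have "switch n ?d = -1"
      by (simp only: unfold restrict_apply'[OF d]) (simp add: a_vals flip_def del: One_nat_def)
    ultimately show ?thesis by simp
  qed
  ultimately show False by simp
qed

theorem corollary3p9:
  fixes n :: nat and M :: "'a measure" and S :: "nat \<Rightarrow> 'a \<Rightarrow> (nat \<Rightarrow> int)"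
  assumes "n \<ge> 4" and "even n"
    and "simple_random_walk n M S"
  shows "\<not> (\<exists>R. R \<in> sign_sequences \<rightarrow>\<^sub>M count_space (sceneries n) \<and>
            (\<forall>f\<in>sceneries n. AE \<omega> in M. isomorphic_sceneries n (R (\<lambda>i. f (S i \<omega>))) f))"
proof
  interpret prob_space M using assms(3) unfolding simple_random_walk_def by blast
  interpret cube_walk M n S using assms by unfold_locales auto
  let ?f = "monomial n" and ?g = "switch n"
  let ?X = "\<lambda>h \<omega> i. h (S i \<omega>)"
  have bal: "balanced n ?f" "balanced n ?g"
    using assms by (auto intro: monomial_balanced switch_balanced)
  then have scen: "?f \<in> sceneries n" "?g \<in> sceneries n" unfolding balanced_def by auto
  assume "\<exists>R. R \<in> sign_sequences \<rightarrow>\<^sub>M count_space (sceneries n) \<and>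
            (\<forall>f\<in>sceneries n. AE \<omega> in M. isomorphic_sceneries n (R (\<lambda>i. f (S i \<omega>))) f)"
  then obtain R where R: "R \<in> sign_sequences \<rightarrow>\<^sub>M count_space (sceneries n)"
    and ae: "\<And>f. f \<in> sceneries n \<Longrightarrow> AE \<omega> in M. isomorphic_sceneries n (R (?X f \<omega>)) f"
    by blast
  have meas: "{s \<in> space sign_sequences. isomorphic_sceneries n (R s) h} \<in> sets sign_sequences" for h
  proof -
    have "{s \<in> space sign_sequences. isomorphic_sceneries n (R s) h} =
        R -` {r \<in> sceneries n. isomorphic_sceneries n r h} \<inter> space sign_sequences"
      using measurable_space[OF R] by auto
    also have "\<dots> \<in> sets sign_sequences" by (rule measurable_sets[OF R]) auto
    finally show ?thesis .
  qed
  have law: "AE s in distr M sign_sequences (?X h). isomorphic_sceneries n (R s) h"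
    if "h \<in> sceneries n" for h
    using ae[OF that] AE_distr_iff[OF scenery_process_measurable[OF that] meas] by blast
  have "AE s in distr M sign_sequences (?X ?f).
      isomorphic_sceneries n (R s) ?f \<and> isomorphic_sceneries n (R s) ?g"
    using law[OF scen(1)] law[OF scen(2)] unfolding balanced_same_law[OF bal] by eventually_elim simp
  moreover have "prob_space (distr M sign_sequences (?X ?f))"
    by (intro prob_space_distr scenery_process_measurable scen)
  ultimately obtain s where "isomorphic_sceneries n (R s) ?f" "isomorphic_sceneries n (R s) ?g"
    using eventually_happens'[OF prob_space.ae_filter_bot] by blast
  then have "positive_cycles n ?g"
    using positive_cycles_isomorphic isomorphic_sceneries_sym monomial_positive_cycles by metis
  then show False using switch_not_positive_cycles assms(1) by blast
qed

end
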